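(* Let $p,q$ be nonnegative integers. If $p\ge 1$ and $q\ge 1$, then $|E(A_{p,q})|=q\binom{p+q-1}{p-1}$; and if $pq=0$, then $|E(A_{p,q})|=0$.
   Context: For nonnegative integers $p,q$, the graph $A_{p,q}$ is the simple graph whose vertices are all words of length $p+q$ over $\{a,b\}$ with exactly $p$ letters $a$ and $q$ letters $b$; two words are adjacent if one can be obtained from the other by changing one subword (block of two consecutive letters) $ab$ to $ba$. *)

theory Defs
  imports Complex_Main
begin

datatype letter = a | b

definition simple_graph :: "'v set \<Rightarrow> 'v set set \<Rightarrow> bool" where
  "simple_graph V E \<longleftrightarrow> finite V \<and> (\<forall>e\<in>E. e \<subseteq> V \<and> card e = 2)"

definition A_verts :: "nat \<Rightarrow> nat \<Rightarrow> letter list set" where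
  "A_verts p q = {w. length w = p + q \<and> count_list w a = p \<and> count_list w b = q}"

definition ab_to_ba :: "letter list \<Rightarrow> letter list \<Rightarrow> bool" where
  "ab_to_ba u v \<longleftrightarrow> (\<exists>x y. u = x @ [a, b] @ y \<and> v = x @ [b, a] @ y)"

definition A_adj :: "letter list \<Rightarrow> letter list \<Rightarrow> bool" where
  "A_adj u v \<longleftrightarrow> ab_to_ba u v \<or> ab_to_ba v u"

definition A_edges :: "nat \<Rightarrow> nat \<Rightarrow> letter list set set" where
  "A_edges p q = {{u, v} | u v. u \<in> A_verts p q \<and> v \<in> A_verts p q \<and> A_adj u v}"

lemma finite_A_verts: "finite (A_verts p q)"
proof (rule finite_subset)
  show "A_verts p q \<subseteq> {w. set w \<subseteq> {a, b} \<and> length w = p + q}"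
    by (auto simp: A_verts_def intro: letter.exhaust)
  show "finite {w. set w \<subseteq> {a, b} \<and> length w = p + q}"
    by (rule finite_lists_length_eq) simp
qed

lemma A_adj_irrefl: "\<not> A_adj u u"
  by (auto simp: A_adj_def ab_to_ba_def)

lemma simple_graph_A: "simple_graph (A_verts p q) (A_edges p q)"
  using A_adj_irrefl finite_A_verts
  by (auto simp: simple_graph_def A_edges_def card_insert_if)

text \<open>In particular \<open>card (A_edges p q)\<close> is a genuine edge count, never the default value for an
  infinite set.\<close>

lemma finite_A_edges: "finite (A_edges p q)"
  using simple_graph_A[of p q] finite_subset[of "A_edges p q" "Pow (A_verts p q)"]
  by (auto simp: simple_graph_def)

end

theory Submission
  imports Defs
begin

text \<open>An edge is determined by the pair \<open>(x, y)\<close> of words around the switched block, since \<open>x\<close> is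
  the longest common prefix of the two end points. So edges correspond to a word \<open>x @ y\<close> with
  \<open>p - 1\<close> letters \<open>a\<close> and \<open>q - 1\<close> letters \<open>b\<close>, together with one of its \<open>p + q - 1\<close> cutting
  positions, and \<open>(p + q - 1) \<cdot> (p + q - 2 choose p - 1) = q \<cdot> (p + q - 1 choose p - 1)\<close>.\<close>

lemma count_list_a_plus_b: "count_list w a + count_list w b = length w"
proof (induction w)
  case (Cons l w)
  then show ?case by (cases l) auto
qed simp

text \<open>Sorting by first letter; on cardinalities this becomes Pascal's rule.\<close>

lemma A_verts_Suc_Suc:
  "A_verts (Suc p) (Suc q) = (#) a ` A_verts p (Suc q) \<union> (#) b ` A_verts (Suc p) q" (is "?L = ?R")
proof (rule set_eqI)
  fix w
  show "w \<in> ?L \<longleftrightarrow> w \<in> ?R"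
  proof (cases w)
    case (Cons l u)
    then show ?thesis by (cases l) (auto simp: A_verts_def)
  qed (auto simp: A_verts_def)
qed

lemma A_verts_0_left: "A_verts 0 q = {replicate q b}"
proof -
  have "w = replicate q b" if "w \<in> A_verts 0 q" for w
    using that unfolding A_verts_def
    by (auto simp: count_list_0_iff) (metis letter.exhaust replicate_eqI)
  moreover have "count_list (replicate q l) k = (if l = k then q else 0)" for l k :: letter
    by (induction q) auto
  ultimately show ?thesis by (auto simp: A_verts_def)
qed

lemma A_verts_0_right: "A_verts p 0 = {replicate p a}"
proof -
  have "w = replicate p a" if "w \<in> A_verts p 0" for w
    using that unfolding A_verts_def
    by (auto simp: count_list_0_iff) (metis letter.exhaust replicate_eqI)
  moreover have "count_list (replicate p l) k = (if l = k then p else 0)" for l k :: letter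
    by (induction p) auto
  ultimately show ?thesis by (auto simp: A_verts_def)
qed

lemma card_A_verts: "card (A_verts p q) = (p + q) choose p"
\<comment> \<open>Induction on word length, because removing the first letter lowers either
  \<open>p\<close> or \<open>q\<close>.\<close>
proof (induction "p + q" arbitrary: p q)
  case 0
  then show ?case by (simp add: A_verts_0_left)
next
  case (Suc n)
  show ?case
  proof (cases "p = 0 \<or> q = 0")
    case True
    then show ?thesis by (auto simp: A_verts_0_left A_verts_0_right)
  next
    case False
    then obtain p' q' where pq: "p = Suc p'" "q = Suc q'"
      by (metis not0_implies_Suc)
    have "card (A_verts p q) = card (A_verts p' (Suc q')) + card (A_verts (Suc p') q')"
      unfolding pq A_verts_Suc_Suc
      by (subst card_Un_disjoint) (auto simp: finite_A_verts card_image)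
    also have "\<dots> = (p' + Suc q' choose p') + (Suc p' + q' choose Suc p')"
      using Suc pq by simp
    finally show ?thesis by (simp add: pq)
  qed
qed

definition switch_edge :: "letter list \<times> letter list \<Rightarrow> letter list set" where
  "switch_edge = (\<lambda>(x, y). {x @ [a, b] @ y, x @ [b, a] @ y})"

text \<open>Both directions of \<open>A_adj\<close> give the same unordered pair, so one orientation
  suffices.\<close>

lemma A_edges_iff_switch_edge:
  "e \<in> A_edges p q \<longleftrightarrow> (\<exists>x y. e = switch_edge (x, y) \<and> e \<subseteq> A_verts p q)"
  unfolding A_edges_def A_adj_def ab_to_ba_def switch_edge_def
  by (auto simp: insert_commute)

text \<open>The switched block uses one letter of each kind. The bounds on \<open>p\<close> and
  \<open>q\<close> guard against truncated subtraction at 0.\<close>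

lemma switch_edge_subset_A_verts_iff:
  "switch_edge (x, y) \<subseteq> A_verts p q \<longleftrightarrow> p \<ge> 1 \<and> q \<ge> 1 \<and> x @ y \<in> A_verts (p - 1) (q - 1)"
  using count_list_a_plus_b[of x] count_list_a_plus_b[of y]
  by (auto simp: switch_edge_def A_verts_def)

lemma A_edges_eq_image:
  "A_edges p q = switch_edge ` {(x, y). p \<ge> 1 \<and> q \<ge> 1 \<and> x @ y \<in> A_verts (p - 1) (q - 1)}"
  by (fastforce simp: A_edges_iff_switch_edge switch_edge_subset_A_verts_iff)

text \<open>The two end points of \<open>switch_edge (x, y)\<close> differ at position \<open>length x\<close>, but agree on the
  prefix of any longer description.\<close>

lemma switch_edge_length_le:
  assumes "switch_edge (x, y) = switch_edge (x', y')"
  shows "length x' \<le> length x"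
proof (rule ccontr)
  assume "\<not> length x' \<le> length x"
  then have "w ! length x = x' ! length x" if "w \<in> switch_edge (x', y')" for w
    using that by (auto simp: switch_edge_def nth_append)
  from this[of "x @ [a, b] @ y"] this[of "x @ [b, a] @ y"] show False
    by (simp flip: assms) (simp add: switch_edge_def nth_append)
qed

lemma inj_switch_edge: "inj switch_edge"
proof (rule injI)
  fix s t :: "letter list \<times> letter list"
  assume eq: "switch_edge s = switch_edge t"
  obtain x y x' y' where st: "s = (x, y)" "t = (x', y')" by fastforce
  have "length x = length x'"
    using switch_edge_length_le eq st by (metis le_antisym)
  \<comment> \<open>With equal prefix lengths, a crosswise matching of end points would equate
    \<open>a\<close> with \<open>b\<close> right after the prefix.\<close>
  then show "s = t"
    using eq by (auto simp: st switch_edge_def doubleton_eq_iff)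
qed

text \<open>The cutting position ranges over 0 to \<open>n\<close>, as either piece may be
  empty.\<close>

lemma card_splittings:
  assumes "\<And>w. w \<in> W \<Longrightarrow> length w = n"
  shows "card {(x, y). x @ y \<in> W} = Suc n * card W"
proof -
  have "bij_betw (\<lambda>(k, w). (take k w, drop k w)) ({..n} \<times> W) {(x, y). x @ y \<in> W}"
    by (rule bij_betw_byWitness[where f' = "\<lambda>(x, y). (length x, x @ y)"])
       (use assms in \<open>force simp: min_def\<close>)+
  then show ?thesis
    by (simp add: bij_betw_same_card[symmetric] card_cartesian_product)
qed

theorem theorem3p2:
  fixes p q :: nat
  shows "(p \<ge> 1 \<and> q \<ge> 1 \<longrightarrow> card (A_edges p q) = q * ((p + q - 1) choose (p - 1)))
       \<and> (p * q = 0 \<longrightarrow> card (A_edges p q) = 0)"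
proof (intro conjI impI)
  assume "p \<ge> 1 \<and> q \<ge> 1"
  then obtain m n where pq: "p = Suc m" "q = Suc n"
    by (metis Suc_le_D One_nat_def)
  have "card (A_edges p q) = card {(x, y). x @ y \<in> A_verts m n}"
    unfolding A_edges_eq_image
    by (subst card_image) (auto simp: pq intro: inj_on_subset[OF inj_switch_edge])
  \<comment> \<open>Choosing \<open>n\<close> rather than \<open>m\<close> lets the absorption
    identity produce the factor \<open>Suc n\<close>, which is \<open>q\<close>.\<close>
  also have "\<dots> = Suc (m + n) * ((m + n) choose n)"
    by (subst card_splittings[of _ "m + n"])
       (auto simp: A_verts_def[of m n, THEN eqset_imp_iff] card_A_verts binomial_symmetric[of m "m + n"])
  also have "\<dots> = Suc n * (Suc (m + n) choose Suc n)"
    by (simp only: Suc_times_binomial)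
  also have "Suc (m + n) choose Suc n = Suc (m + n) choose m"
    using binomial_symmetric[of m "Suc (m + n)"] by simp
  finally show "card (A_edges p q) = q * ((p + q - 1) choose (p - 1))"
    by (simp add: pq)
next
  assume "p * q = 0"
  then show "card (A_edges p q) = 0"
    \<comment> \<open>The index set of the image is empty here.\<close>
    by (auto simp: A_edges_eq_image)
qed

end
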